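(* Let $X$ be a Banach space and let $Y$ be a closed subspace of $X$. If $X$ has the SSD2P and $Y$ is an ai-ideal in $X$, then $Y$ has the SSD2P.
   Context: All Banach spaces are nontrivial (i.e. $\neq\{0\}$) and over the real field. $B_X$ and $S_X$ denote the closed unit ball and unit sphere of $X$, and $X^*$ its dual. A slice of $B_X$ is a set $S(B_X,x^*,\alpha)=\{x\in B_X: x^*(x)>1-\alpha\}$ with $x^*\in S_{X^*}$ and $\alpha>0$. A Banach space $X$ has the symmetric strong diameter 2 property (SSD2P) if for every finite family $\{S_i\}_{i=1}^n$ of slices of $B_X$ and every $\varepsilon>0$ there exist $x_i\in S_i$ and $y\in B_X$, with $y$ independent of $i$, such that $x_i\pm y\in S_i$ for every $i\in\{1,\dots,n\}$ and $\|y\|>1-\varepsilon$. A subspace $Y$ of $X$ is an almost isometric ideal (ai-ideal) in $X$ if for every finite-dimensional subspace $E$ of $X$ and every $\varepsilon>0$ there exists a bounded linear operator $T:E\to Y$ such that $(1-\varepsilon)\|e\|\le\|Te\|\le(1+\varepsilon)\|e\|$ for all $e\in E$ and $Te=e$ for all $e\in E\cap Y$. *)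

theory Defs
  imports "HOL-Analysis.Analysis"
begin

text \<open>
  A Banach space is either a whole type of class \<^class>\<open>banach\<close> (taken as \<open>UNIV\<close>) or a closed
  subspace of one, so the notions below are relative to a carrier set that is a linear subspace.
  A map on a carrier is represented by a total function, whose values off the carrier are
  arbitrary and never used.
\<close>

definition bounded_linear_on :: "'a::real_normed_vector set \<Rightarrow> ('a \<Rightarrow> 'b::real_normed_vector) \<Rightarrow> bool"
  where "bounded_linear_on E T \<longleftrightarrow>
    (\<forall>x\<in>E. \<forall>y\<in>E. T (x + y) = T x + T y) \<and>
    (\<forall>c. \<forall>x\<in>E. T (c *\<^sub>R x) = c *\<^sub>R T x) \<and>
    (\<exists>K. \<forall>x\<in>E. norm (T x) \<le> norm x * K)"

text \<open>The operator norm of the restriction to \<open>E\<close>, following \<^const>\<open>onorm\<close> (at \<open>x = 0\<close> the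
  quotient is \<open>0\<close>).\<close>

definition onorm_on :: "'a::real_normed_vector set \<Rightarrow> ('a \<Rightarrow> 'b::real_normed_vector) \<Rightarrow> real"
  where "onorm_on E T = (SUP x\<in>E. norm (T x) / norm x)"

definition dual_sphere :: "'a::real_normed_vector set \<Rightarrow> ('a \<Rightarrow> real) set"
  where "dual_sphere X = {f. bounded_linear_on X f \<and> onorm_on X f = 1}"

definition unit_ball :: "'a::real_normed_vector set \<Rightarrow> 'a set"
  where "unit_ball X = {x \<in> X. norm x \<le> 1}"

definition slice :: "'a::real_normed_vector set \<Rightarrow> ('a \<Rightarrow> real) \<Rightarrow> real \<Rightarrow> 'a set"
  where "slice X f \<alpha> = {x \<in> unit_ball X. f x > 1 - \<alpha>}"

definition is_slice :: "'a::real_normed_vector set \<Rightarrow> 'a set \<Rightarrow> bool"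
  where "is_slice X S \<longleftrightarrow> (\<exists>f\<in>dual_sphere X. \<exists>\<alpha>>0. S = slice X f \<alpha>)"

definition SSD2P :: "'a::real_normed_vector set \<Rightarrow> bool"
  where "SSD2P X \<longleftrightarrow>
    (\<forall>(n::nat) (S :: nat \<Rightarrow> 'a set) (\<epsilon>::real).
      (\<forall>i\<in>{1..n}. is_slice X (S i)) \<longrightarrow> \<epsilon> > 0 \<longrightarrow>
      (\<exists>(x :: nat \<Rightarrow> 'a) y. y \<in> unit_ball X \<and> norm y > 1 - \<epsilon> \<and>
        (\<forall>i\<in>{1..n}. x i \<in> S i \<and> x i + y \<in> S i \<and> x i - y \<in> S i)))"

text \<open>The ambient space is the whole type. A finite-dimensional subspace is the span of a finite
  set; \<^const>\<open>dim\<close> cannot be used, being \<open>0\<close> on infinite-dimensional subspaces.\<close>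

definition ai_ideal :: "'a::real_normed_vector set \<Rightarrow> bool"
  where "ai_ideal Y \<longleftrightarrow> subspace Y \<and>
    (\<forall>(E :: 'a set) (\<epsilon>::real).
      subspace E \<longrightarrow> (\<exists>B. finite B \<and> span B = E) \<longrightarrow> \<epsilon> > 0 \<longrightarrow>
      (\<exists>T :: 'a \<Rightarrow> 'a. bounded_linear_on E T \<and> T ` E \<subseteq> Y \<and>
        (\<forall>e\<in>E. (1 - \<epsilon>) * norm e \<le> norm (T e) \<and> norm (T e) \<le> (1 + \<epsilon>) * norm e) \<and>
        (\<forall>e\<in>E \<inter> Y. T e = e)))"

text \<open>On a whole type the relative notions are those of the library.\<close>

lemma bounded_linear_on_UNIV: "bounded_linear_on UNIV T \<longleftrightarrow> bounded_linear T"
  by (auto simp: bounded_linear_on_def bounded_linear_def bounded_linear_axioms_def linear_iff)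

lemma onorm_on_UNIV: "onorm_on UNIV T = onorm T"
  by (simp add: onorm_on_def onorm_def)

lemma dual_sphere_UNIV:
  "dual_sphere (UNIV :: 'a::real_normed_vector set) = blinfun_apply ` {g :: 'a \<Rightarrow>\<^sub>L real. norm g = 1}"
  unfolding dual_sphere_def bounded_linear_on_UNIV onorm_on_UNIV
  by (auto simp: norm_blinfun.rep_eq blinfun.bounded_linear_right image_iff)
     (metis bounded_linear_Blinfun_apply)

end

theory Submission
  imports Defs
begin

text \<open>
  The idea is to enlarge the given slices of the ball of \<open>Y\<close> to slices of the ball of the ambient
  space, apply the property there, and push the resulting points down into \<open>Y\<close> by an almost
  isometry \<open>T\<close>.  An arbitrary norm-preserving (Hahn--Banach) extension \<open>F\<close> of a functional \<open>f\<close>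
  on \<open>Y\<close> need not do: \<open>f (T z)\<close> has to be close to \<open>F z\<close> for the points \<open>z\<close> that are pushed down,
  and these points are known only after \<open>F\<close> has been chosen.

  So the extensions are manufactured from the operators themselves.  The almost isometries
  \<open>T\<close> on \<open>span A\<close> with tolerance \<open>\<epsilon>\<close> form a net, indexed by the finite sets \<open>A\<close>
  and \<open>\<epsilon> \<rightarrow> 0\<close>.  The values \<open>f\<^sub>i (T x)\<close> are bounded by \<open>(1 + \<epsilon>) \<parallel>x\<parallel>\<close>, so by Tychonoff's theorem the
  net of functions \<open>(i, x) \<mapsto> f\<^sub>i (T x)\<close> has a pointwise cluster point \<open>F\<close>
  (\<open>pointwise_cluster_point\<close>).  Each \<open>F\<^sub>i\<close> is linear of norm one and extends \<open>f\<^sub>i\<close>, and being a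
  cluster point it is matched by some \<open>f\<^sub>i \<circ> T\<close> on any prescribed finite set, to any precision
  (\<open>ai_ideal_approximable_extensions\<close>).  This gives what is needed, for all the functionals at
  once.  The vectors \<open>T z\<close> may be slightly longer than one, so \<open>T\<close> is finally divided
  by \<open>1 + \<epsilon>\<close>; the loss is absorbed by having used smaller slices upstairs.
\<close>

section \<open>Pointwise cluster points\<close>

text \<open>
  This is Tychonoff's theorem for the product of the intervals \<open>[- b k, b k]\<close>.  The bound is only
  required eventually and separately for each coordinate, hence the truncation in the proof:
  it moves the whole net into the product without changing any finite set of coordinates in the
  long run.
\<close>

lemma pointwise_cluster_point:
  fixes g :: "'c \<Rightarrow> 'k \<Rightarrow> real"
  assumes "L \<noteq> bot" and bound: "\<And>k. \<forall>\<^sub>F c in L. \<bar>g c k\<bar> \<le> b k"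
  shows "\<exists>F. \<forall>K \<delta>. finite K \<longrightarrow> 0 < \<delta> \<longrightarrow> (\<exists>\<^sub>F c in L. \<forall>k\<in>K. \<bar>g c k - F k\<bar> < \<delta>)"
proof -
  define h where "h = (\<lambda>c k. max (- b k) (min (b k) (g c k)))"
  have b: "0 \<le> b k" for k
    using eventually_happens'[OF assms(1) bound[of k]] by fastforce
  let ?U = "PiE UNIV (\<lambda>k. {- b k..b k})"
  have "compactin (product_topology (\<lambda>k. euclidean) UNIV) ?U"
    by (subst compactin_PiE) auto
  then have "compact ?U"
    by (simp add: euclidean_product_topology)
  moreover have "filtermap h L \<noteq> bot"
    using assms(1) by (simp add: filtermap_bot_iff)
  moreover have "h c \<in> ?U" for c
    using b by (auto simp: h_def PiE_def min_def max_def)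
  ultimately obtain F where F: "inf (nhds F) (filtermap h L) \<noteq> bot"
    unfolding compact_filter by (fastforce simp: eventually_filtermap)
  have "\<exists>\<^sub>F c in L. \<forall>k\<in>K. \<bar>g c k - F k\<bar> < \<delta>" if "finite K" "0 < \<delta>" for K \<delta>
  proof (rule ccontr)
    assume "\<not> ?thesis"
    then have *: "\<forall>\<^sub>F c in L. \<not> (\<forall>k\<in>K. \<bar>g c k - F k\<bar> < \<delta>)"
      by (simp add: frequently_def)
    have "\<forall>\<^sub>F c in L. \<forall>k\<in>K. \<bar>g c k\<bar> \<le> b k"
      using bound \<open>finite K\<close> by (simp add: eventually_ball_finite_distrib)
    with * have "\<forall>\<^sub>F c in L. \<not> (\<forall>k\<in>K. \<bar>h c k - F k\<bar> < \<delta>)"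
    proof eventually_elim
      case (elim c)
      then have "\<forall>k\<in>K. h c k = g c k" by (force simp: h_def)
      with elim show ?case by auto
    qed
    then have 1: "\<forall>\<^sub>F G in filtermap h L. \<not> (\<forall>k\<in>K. \<bar>G k - F k\<bar> < \<delta>)"
      by (simp add: eventually_filtermap)
    have "\<forall>\<^sub>F G in nhds F. \<bar>G k - F k\<bar> < \<delta>" for k
    proof -
      have "open {G::'k \<Rightarrow> real. \<bar>G k - F k\<bar> < \<delta>}"
        by (intro open_Collect_less continuous_intros continuous_on_product_coordinates)
      from eventually_nhds_in_open[OF this, of F] \<open>0 < \<delta>\<close> show ?thesis by simp
    qed
    then have 2: "\<forall>\<^sub>F G in nhds F. \<forall>k\<in>K. \<bar>G k - F k\<bar> < \<delta>"
      using \<open>finite K\<close> by (simp add: eventually_ball_finite_distrib)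
    have "\<forall>\<^sub>F G in inf (nhds F) (filtermap h L). False"
      unfolding eventually_inf using 1 2 by blast
    with F show False by (simp add: trivial_limit_def)
  qed
  then show ?thesis by blast
qed

section \<open>Functionals of norm one on a subspace\<close>

lemma dual_sphere_abs_le:
  assumes "f \<in> dual_sphere Y" "x \<in> Y"
  shows "\<bar>f x\<bar> \<le> norm x"
proof -
  obtain K where K: "\<forall>x\<in>Y. norm (f x) \<le> norm x * K" and 1: "(SUP x\<in>Y. norm (f x) / norm x) = 1"
    using assms(1) by (auto simp: dual_sphere_def bounded_linear_on_def onorm_on_def)
  have "bdd_above ((\<lambda>x. norm (f x) / norm x) ` Y)"
  proof (rule bdd_aboveI2)
    fix x assume "x \<in> Y"
    then show "norm (f x) / norm x \<le> max K 0"
      using bspec[OF K \<open>x \<in> Y\<close>] by (cases "x = 0") (auto simp: pos_divide_le_eq mult.commute le_max_iff_disj)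
  qed
  with 1 assms(2) have "norm (f x) / norm x \<le> 1"
    by (metis cSUP_upper)
  moreover have "x = 0 \<Longrightarrow> f x = 0"
    using bspec[OF K assms(2)] by simp
  ultimately show ?thesis
    by (cases "x = 0") (auto simp: divide_simps)
qed

text \<open>The extension has norm at least one because the supremum is already one on \<open>Y\<close>.\<close>

lemma dual_sphere_extension:
  fixes F :: "'a::real_normed_vector \<Rightarrow> real"
  assumes "f \<in> dual_sphere Y" "Y \<noteq> {}" "linear F"
    and le: "\<And>x. \<bar>F x\<bar> \<le> norm x" and ext: "\<And>x. x \<in> Y \<Longrightarrow> F x = f x"
  shows "F \<in> dual_sphere UNIV"
proof -
  have "bounded_linear F"
    using assms(3) le by (intro bounded_linear_intro[where K = 1]) (auto simp: linear_add linear_scale)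
  have q: "norm (F x) / norm x \<le> 1" for x
    using le[of x] by (cases "x = 0") auto
  have "1 = (SUP x\<in>Y. norm (F x) / norm x)"
    using assms(1) ext by (simp add: dual_sphere_def onorm_on_def cong: image_cong_simp)
  also have "\<dots> \<le> (SUP x. norm (F x) / norm x)"
    using q \<open>Y \<noteq> {}\<close> by (intro cSUP_subset_mono bdd_aboveI2[where M = 1]) auto
  finally have "1 \<le> (SUP x. norm (F x) / norm x)" .
  moreover have "(SUP x. norm (F x) / norm x) \<le> 1"
    using q by (intro cSUP_least) auto
  ultimately have "onorm_on UNIV F = 1"
    by (simp only: onorm_on_def antisym)
  with \<open>bounded_linear F\<close> show ?thesis
    by (simp add: dual_sphere_def bounded_linear_on_UNIV)
qed

lemma slice_mono: "\<alpha> \<le> \<beta> \<Longrightarrow> slice X f \<alpha> \<subseteq> slice X f \<beta>"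
  by (auto simp: slice_def)

section \<open>Extensions matched by almost isometries\<close>

definition ai_operator :: "'a::real_normed_vector set \<Rightarrow> 'a set \<Rightarrow> real \<Rightarrow> ('a \<Rightarrow> 'a) \<Rightarrow> bool"
  where "ai_operator Y E \<epsilon> T \<longleftrightarrow> bounded_linear_on E T \<and> T ` E \<subseteq> Y \<and>
    (\<forall>e\<in>E. (1 - \<epsilon>) * norm e \<le> norm (T e) \<and> norm (T e) \<le> (1 + \<epsilon>) * norm e) \<and>
    (\<forall>e\<in>E \<inter> Y. T e = e)"

lemma ai_operatorD:
  assumes "ai_operator Y E \<epsilon> T"
  shows "\<And>x y. x \<in> E \<Longrightarrow> y \<in> E \<Longrightarrow> T (x + y) = T x + T y"
    and "\<And>c x. x \<in> E \<Longrightarrow> T (c *\<^sub>R x) = c *\<^sub>R T x"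
    and "\<And>x. x \<in> E \<Longrightarrow> T x \<in> Y"
    and "\<And>x. x \<in> E \<Longrightarrow> (1 - \<epsilon>) * norm x \<le> norm (T x)"
    and "\<And>x. x \<in> E \<Longrightarrow> norm (T x) \<le> (1 + \<epsilon>) * norm x"
    and "\<And>x. x \<in> E \<Longrightarrow> x \<in> Y \<Longrightarrow> T x = x"
  using assms by (auto simp: ai_operator_def bounded_linear_on_def)

lemma ai_operator_mono:
  assumes T: "ai_operator Y E \<epsilon> T" and "D \<subseteq> E" "\<epsilon> \<le> \<delta>"
  shows "ai_operator Y D \<delta> T"
proof -
  have "(1 - \<delta>) * norm e \<le> norm (T e) \<and> norm (T e) \<le> (1 + \<delta>) * norm e" if "e \<in> D" for e
  proof -
    have "e \<in> E" using that \<open>D \<subseteq> E\<close> by blast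
    moreover have "(1 - \<delta>) * norm e \<le> (1 - \<epsilon>) * norm e" "(1 + \<epsilon>) * norm e \<le> (1 + \<delta>) * norm e"
      using \<open>\<epsilon> \<le> \<delta>\<close> by (auto intro!: mult_right_mono)
    ultimately show ?thesis using ai_operatorD(4,5)[OF T] by (meson order_trans)
  qed
  moreover have "bounded_linear_on D T"
    using T \<open>D \<subseteq> E\<close> unfolding ai_operator_def bounded_linear_on_def by (meson subsetD)
  ultimately show ?thesis
    using ai_operatorD(3,6)[OF T] \<open>D \<subseteq> E\<close> unfolding ai_operator_def by blast
qed

lemma eq_if_close:
  fixes a b :: real
  assumes "\<And>\<delta>. 0 < \<delta> \<Longrightarrow> \<bar>a - b\<bar> \<le> C * \<delta>" "0 < C"
  shows "a = b"
proof (rule ccontr)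
  assume "a \<noteq> b"
  with assms(1)[of "\<bar>a - b\<bar> / (2 * C)"] \<open>0 < C\<close> show False by (simp add: field_simps)
qed

text \<open>
  The almost isometries form a net along the finite sets \<open>A\<close> and \<open>\<epsilon> \<rightarrow> 0\<close>, and \<open>F i x\<close> is the
  value at \<open>(i, x)\<close> of a cluster point of the functions \<open>(i, x) \<mapsto> f i (T x)\<close>.  Additivity, homogeneity, the norm bound and
  agreement with \<open>f i\<close> on \<open>Y\<close> each concern at most three points; at these, \<open>F i\<close> is as close as one
  likes to some \<open>f i \<circ> T\<close> with the points in the domain of \<open>T\<close>, and this composition has the
  property, up to the factor \<open>1 + \<epsilon>\<close> in the bound.
\<close>

lemma ai_ideal_approximable_extensions:
  fixes Y :: "'a::real_normed_vector set" and f :: "'i \<Rightarrow> 'a \<Rightarrow> real"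
  assumes "ai_ideal Y" and "finite I" and f: "\<And>i. i \<in> I \<Longrightarrow> f i \<in> dual_sphere Y"
  obtains F where "\<And>i. i \<in> I \<Longrightarrow> F i \<in> dual_sphere UNIV"
    and "\<And>B \<delta>. finite B \<Longrightarrow> 0 < \<delta> \<Longrightarrow>
      \<exists>T. ai_operator Y (span B) \<delta> T \<and> (\<forall>i\<in>I. \<forall>x\<in>B. \<bar>f i (T x) - F i x\<bar> < \<delta>)"
proof -
  have Y: "subspace Y" using assms(1) by (simp add: ai_ideal_def)
  have "\<exists>T. ai_operator Y (span A) \<epsilon> T" if "finite A" "0 < \<epsilon>" for A \<epsilon>
    using assms(1) that subspace_span[of A]
    unfolding ai_ideal_def ai_operator_def by blast
  then obtain T where T: "\<And>A \<epsilon>. finite A \<Longrightarrow> 0 < \<epsilon> \<Longrightarrow> ai_operator Y (span A) \<epsilon> (T A \<epsilon>)"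
    by metis
  define L :: "('a set \<times> real) filter" where "L = finite_subsets_at_top UNIV \<times>\<^sub>F at_right 0"
  have "L \<noteq> bot" by (simp add: L_def prod_filter_eq_bot)
  have late: "\<forall>\<^sub>F (A, \<epsilon>) in L. finite A \<and> B \<subseteq> A \<and> 0 < \<epsilon> \<and> \<epsilon> < \<delta>" if "finite B" "0 < \<delta>" for B \<delta>
  proof -
    have "\<forall>\<^sub>F A in finite_subsets_at_top UNIV. finite A \<and> B \<subseteq> A"
      using that by (auto simp: eventually_finite_subsets_at_top)
    moreover have "\<forall>\<^sub>F \<epsilon> in at_right 0. 0 < \<epsilon> \<and> \<epsilon> < \<delta>"
      using that by (auto simp: eventually_at_right_field)
    ultimately show ?thesis
      unfolding L_def by (rule eventually_prodI[THEN eventually_mono]) auto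
  qed
  have fT: "\<bar>f i (T A \<epsilon> x)\<bar> \<le> (1 + \<epsilon>) * norm x"
    if "finite A" "x \<in> span A" "0 < \<epsilon>" "i \<in> I" for A \<epsilon> x i
    using dual_sphere_abs_le[OF f] ai_operatorD(3,5)[OF T] that by (meson order_trans)
  define g where "g = (\<lambda>(A, \<epsilon>) (i, x). if i \<in> I then f i (T A \<epsilon> x) else 0)"
  \<comment> \<open>The factor two stands for \<open>1 + \<epsilon>\<close> with \<open>\<epsilon> < 1\<close>; the sharp bound for \<open>F\<close> comes afterwards.\<close>
  have "\<forall>\<^sub>F c in L. \<bar>g c k\<bar> \<le> 2 * norm (snd k)" for k
  proof (rule eventually_mono[OF late[of "{snd k}" 1]])
    fix c :: "'a set \<times> real"
    assume c: "case c of (A, \<epsilon>) \<Rightarrow> finite A \<and> {snd k} \<subseteq> A \<and> 0 < \<epsilon> \<and> \<epsilon> < 1"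
    obtain A \<epsilon> i x where [simp]: "c = (A, \<epsilon>)" "k = (i, x)" by (cases c, cases k)
    have "(1 + \<epsilon>) * norm x \<le> 2 * norm x" using c by (intro mult_right_mono) auto
    then show "\<bar>g c k\<bar> \<le> 2 * norm (snd k)"
      using c fT[of A x \<epsilon> i] by (auto simp: g_def span_base)
  qed auto
  from pointwise_cluster_point[where g = g, OF \<open>L \<noteq> bot\<close> this] obtain G
    where G: "\<forall>K \<delta>. finite K \<longrightarrow> 0 < \<delta> \<longrightarrow> (\<exists>\<^sub>F c in L. \<forall>k\<in>K. \<bar>g c k - G k\<bar> < \<delta>)"
    by (elim exE)
  define F where "F = (\<lambda>i x. G (i, x))"
  have approx: "\<exists>A \<epsilon>. finite A \<and> B \<subseteq> A \<and> 0 < \<epsilon> \<and> \<epsilon> < \<delta> \<and>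
      (\<forall>i\<in>I. \<forall>x\<in>B. \<bar>f i (T A \<epsilon> x) - F i x\<bar> < \<delta>)" if "finite B" "0 < \<delta>" for B \<delta>
  proof -
    have "\<exists>\<^sub>F c in L. \<forall>k\<in>I \<times> B. \<bar>g c k - G k\<bar> < \<delta>"
      using G[rule_format, of "I \<times> B" \<delta>] \<open>finite I\<close> that by simp
    from frequently_ex[OF frequently_eventually_frequently[OF this late[OF that]]]
    obtain A \<epsilon> where "\<forall>k\<in>I \<times> B. \<bar>g (A, \<epsilon>) k - G k\<bar> < \<delta>"
      and "finite A" "B \<subseteq> A" "0 < \<epsilon>" "\<epsilon> < \<delta>"
      by auto
    then show ?thesis
      by (intro exI[of _ A] exI[of _ \<epsilon>]) (auto simp: g_def F_def)
  qed
  show thesis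
  proof
    fix i assume i: "i \<in> I"
    have "F i (x + z) = F i x + F i z" for x z
    proof (rule eq_if_close[where C = 3])
      fix \<delta> :: real assume "0 < \<delta>"
      from approx[of "{x, z, x + z}" \<delta>] this obtain A \<epsilon> where A: "finite A" "x \<in> A" "z \<in> A" "0 < \<epsilon>"
        and *: "\<bar>f i (T A \<epsilon> x) - F i x\<bar> < \<delta>" "\<bar>f i (T A \<epsilon> z) - F i z\<bar> < \<delta>"
          "\<bar>f i (T A \<epsilon> (x + z)) - F i (x + z)\<bar> < \<delta>"
        using i by auto
      have "f i (T A \<epsilon> (x + z)) = f i (T A \<epsilon> x) + f i (T A \<epsilon> z)"
        using f[OF i] A ai_operatorD(1,3)[OF T]
        by (simp add: span_base dual_sphere_def bounded_linear_on_def)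
      with * show "\<bar>F i (x + z) - (F i x + F i z)\<bar> \<le> 3 * \<delta>" by linarith
    qed simp
    moreover have "F i (c *\<^sub>R x) = c *\<^sub>R F i x" for c x
    proof (rule eq_if_close[where C = "1 + \<bar>c\<bar>"])
      fix \<delta> :: real assume "0 < \<delta>"
      from approx[of "{x, c *\<^sub>R x}" \<delta>] this obtain A \<epsilon> where A: "finite A" "x \<in> A" "0 < \<epsilon>"
        and *: "\<bar>f i (T A \<epsilon> x) - F i x\<bar> < \<delta>" "\<bar>f i (T A \<epsilon> (c *\<^sub>R x)) - F i (c *\<^sub>R x)\<bar> < \<delta>"
        using i by auto
      have "f i (T A \<epsilon> (c *\<^sub>R x)) = c * f i (T A \<epsilon> x)"
        using f[OF i] A ai_operatorD(2,3)[OF T]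
        by (simp add: span_base dual_sphere_def bounded_linear_on_def)
      then have "F i (c *\<^sub>R x) - c *\<^sub>R F i x
          = c * (f i (T A \<epsilon> x) - F i x) - (f i (T A \<epsilon> (c *\<^sub>R x)) - F i (c *\<^sub>R x))"
        by (simp add: algebra_simps)
      also have "\<bar>\<dots>\<bar> \<le> \<bar>c\<bar> * \<bar>f i (T A \<epsilon> x) - F i x\<bar> + \<delta>"
        using *(2) by (simp only: abs_mult[symmetric])
      also have "\<dots> \<le> \<bar>c\<bar> * \<delta> + \<delta>"
        using *(1) by (intro add_right_mono mult_left_mono) auto
      finally show "\<bar>F i (c *\<^sub>R x) - c *\<^sub>R F i x\<bar> \<le> (1 + \<bar>c\<bar>) * \<delta>" by (simp add: algebra_simps)
    qed simp
    ultimately have "linear (F i)" by (simp add: linear_iff)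
    moreover have "\<bar>F i x\<bar> \<le> norm x" for x
    proof (rule field_le_epsilon)
      fix e :: real assume "0 < e"
      define \<delta> where "\<delta> = e / (norm x + 1)"
      have "0 < \<delta>" using \<open>0 < e\<close> by (simp add: \<delta>_def add_nonneg_pos)
      from approx[of "{x}" \<delta>] this obtain A \<epsilon> where A: "finite A" "x \<in> A" "0 < \<epsilon>" "\<epsilon> < \<delta>"
        and *: "\<bar>f i (T A \<epsilon> x) - F i x\<bar> < \<delta>"
        using i by auto
      have "\<bar>f i (T A \<epsilon> x)\<bar> \<le> (1 + \<epsilon>) * norm x"
        using fT i A by (simp add: span_base)
      also have "\<dots> \<le> (1 + \<delta>) * norm x"
        using A by (intro mult_right_mono) auto
      finally have "\<bar>F i x\<bar> \<le> norm x + \<delta> * (norm x + 1)"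
        using * by (simp add: algebra_simps)
      also have "\<delta> * (norm x + 1) = e"
        using \<open>0 < \<delta>\<close> \<open>0 < e\<close> by (auto simp: \<delta>_def)
      finally show "\<bar>F i x\<bar> \<le> norm x + e" .
    qed
    moreover have "F i x = f i x" if "x \<in> Y" for x
    proof (rule eq_if_close[where C = 1])
      fix \<delta> :: real assume "0 < \<delta>"
      from approx[of "{x}" \<delta>] this obtain A \<epsilon> where A: "finite A" "x \<in> A" "0 < \<epsilon>"
        and *: "\<bar>f i (T A \<epsilon> x) - F i x\<bar> < \<delta>"
        using i by auto
      then show "\<bar>F i x - f i x\<bar> \<le> 1 * \<delta>"
        using ai_operatorD(6)[OF T, of A \<epsilon> x] that by (simp add: span_base)
    qed simp
    ultimately show "F i \<in> dual_sphere UNIV"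
      using f[OF i] subspace_0[OF Y] by (intro dual_sphere_extension[of "f i" Y]) auto
  next
    fix B :: "'a set" and \<delta> :: real assume B: "finite B" "0 < \<delta>"
    from approx[OF this] obtain A \<epsilon> where A: "finite A" "B \<subseteq> A" "0 < \<epsilon>" "\<epsilon> < \<delta>"
      and *: "\<forall>i\<in>I. \<forall>x\<in>B. \<bar>f i (T A \<epsilon> x) - F i x\<bar> < \<delta>" by blast
    have "ai_operator Y (span B) \<delta> (T A \<epsilon>)"
      using ai_operator_mono[OF T[OF A(1,3)] span_mono[OF A(2)]] A(4) by simp
    with * show "\<exists>T. ai_operator Y (span B) \<delta> T \<and> (\<forall>i\<in>I. \<forall>x\<in>B. \<bar>f i (T x) - F i x\<bar> < \<delta>)"
      by blast
  qed
qed

section \<open>Passage of the property to the ideal\<close>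

text \<open>
  This fixes the tolerances: slices shrunk to depth \<open>\<beta> / 2\<close> leave room for an error \<open>\<beta> / 8\<close>,
  made either in replacing \<open>F\<close> by \<open>f \<circ> T\<close> or in the lower norm bound of \<open>T\<close>, followed by
  division by \<open>1 + \<beta> / 8\<close>.
\<close>

lemma scaling_loss:
  fixes \<beta> :: real
  assumes "0 < \<beta>"
  shows "(1 - \<beta>) * (1 + \<beta> / 8) < 1 - \<beta> / 2 - \<beta> / 8"
proof -
  have "(1 - \<beta>) * (1 + \<beta> / 8) = 1 - 7 * \<beta> / 8 - \<beta> * \<beta> / 8" by (simp add: field_simps)
  with assms mult_pos_pos[OF assms assms] show ?thesis by linarith
qed

lemma slice_push_down:
  assumes Y: "subspace Y" and f: "f \<in> dual_sphere Y" and \<beta>: "0 < \<beta>"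
    and T: "ai_operator Y E (\<beta> / 8) T" and z: "z \<in> E" "z \<in> slice UNIV F (\<beta> / 2)"
    and close: "\<bar>f (T z) - F z\<bar> < \<beta> / 8"
  shows "T z /\<^sub>R (1 + \<beta> / 8) \<in> slice Y f \<beta>"
proof -
  have z': "norm z \<le> 1" "F z > 1 - \<beta> / 2" using z(2) by (auto simp: slice_def unit_ball_def)
  have "norm (T z) \<le> (1 + \<beta> / 8) * norm z" using ai_operatorD(5)[OF T] z(1) by blast
  also have "\<dots> \<le> (1 + \<beta> / 8) * 1" using z' \<beta> by (intro mult_left_mono) auto
  finally have n: "norm (T z /\<^sub>R (1 + \<beta> / 8)) \<le> 1" using \<beta> by (simp add: field_simps)
  have TY: "T z \<in> Y" using ai_operatorD(3)[OF T] z(1) by blast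
  then have "f (T z /\<^sub>R (1 + \<beta> / 8)) = f (T z) / (1 + \<beta> / 8)"
    using f by (simp add: dual_sphere_def bounded_linear_on_def field_simps)
  moreover have "(1 - \<beta>) * (1 + \<beta> / 8) < f (T z)"
    using scaling_loss[OF \<beta>] close z' by linarith
  ultimately have "1 - \<beta> < f (T z /\<^sub>R (1 + \<beta> / 8))"
    using \<beta> by (simp add: pos_less_divide_eq)
  with n TY Y show ?thesis
    by (simp add: slice_def unit_ball_def subspace_scale)
qed

theorem proposition4p1:
  fixes Y :: "'a::banach set"
  assumes "(UNIV :: 'a set) \<noteq> {0}" and "Y \<noteq> {0}"
    and "subspace Y" and "closed Y"
    and "SSD2P (UNIV :: 'a set)"
    and "ai_ideal Y"
  shows "SSD2P Y"
  unfolding SSD2P_def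
proof (intro allI impI)
  fix n :: nat and S :: "nat \<Rightarrow> 'a set" and \<epsilon> :: real
  assume S: "\<forall>i\<in>{1..n}. is_slice Y (S i)" and "0 < \<epsilon>"
  have "\<forall>i\<in>{1..n}. \<exists>p. fst p \<in> dual_sphere Y \<and> 0 < snd p \<and> S i = slice Y (fst p) (snd p)"
    using S unfolding is_slice_def by force
  from bchoice[OF this] obtain p where p: "\<forall>i\<in>{1..n}. fst (p i) \<in> dual_sphere Y \<and> 0 < snd (p i) \<and>
      S i = slice Y (fst (p i)) (snd (p i))" ..
  define f \<alpha> where "f = fst \<circ> p" and "\<alpha> = snd \<circ> p"
  with p have f: "\<And>i. i \<in> {1..n} \<Longrightarrow> f i \<in> dual_sphere Y"
    and \<alpha>: "\<And>i. i \<in> {1..n} \<Longrightarrow> 0 < \<alpha> i" and S_eq: "\<And>i. i \<in> {1..n} \<Longrightarrow> S i = slice Y (f i) (\<alpha> i)"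
    by auto
  \<comment> \<open>One depth for all slices, also small enough for the norm of the final vector; the
    inserted element keeps the set nonempty when \<open>n = 0\<close>.\<close>
  define \<beta> where "\<beta> = Min (insert (min 1 \<epsilon>) (\<alpha> ` {1..n}))"
  have \<beta>: "0 < \<beta>" "\<beta> \<le> 1" "\<beta> \<le> \<epsilon>" "\<And>i. i \<in> {1..n} \<Longrightarrow> \<beta> \<le> \<alpha> i"
  proof -
    have "\<beta> \<le> c" if "c \<in> insert (min 1 \<epsilon>) (\<alpha> ` {1..n})" for c
      using that unfolding \<beta>_def by (intro Min_le) auto
    from this[of "min 1 \<epsilon>"] this[of "\<alpha> i" for i] show "\<beta> \<le> 1" "\<beta> \<le> \<epsilon>" "\<And>i. i \<in> {1..n} \<Longrightarrow> \<beta> \<le> \<alpha> i"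
      by auto
    show "0 < \<beta>" using \<alpha> \<open>0 < \<epsilon>\<close> by (auto simp: \<beta>_def)
  qed
  obtain F where F: "\<And>i. i \<in> {1..n} \<Longrightarrow> F i \<in> dual_sphere UNIV"
    and approx: "\<And>B \<delta>. finite B \<Longrightarrow> 0 < \<delta> \<Longrightarrow>
      \<exists>T. ai_operator Y (span B) \<delta> T \<and> (\<forall>i\<in>{1..n}. \<forall>x\<in>B. \<bar>f i (T x) - F i x\<bar> < \<delta>)"
    using ai_ideal_approximable_extensions[where I = "{1..n}" and f = f, OF \<open>ai_ideal Y\<close> _ f]
    by (metis finite_atLeastAtMost)
  have "is_slice UNIV (slice UNIV (F i) (\<beta> / 2))" if "i \<in> {1..n}" for i
    using F[OF that] \<beta>(1) unfolding is_slice_def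
    by (intro bexI[of _ "F i"] exI[of _ "\<beta> / 2"]) auto
  then have "\<exists>x y. y \<in> unit_ball UNIV \<and> norm y > 1 - \<beta> / 2 \<and>
      (\<forall>i\<in>{1..n}. x i \<in> slice UNIV (F i) (\<beta> / 2) \<and>
        x i + y \<in> slice UNIV (F i) (\<beta> / 2) \<and> x i - y \<in> slice UNIV (F i) (\<beta> / 2))"
    using \<open>SSD2P UNIV\<close>[unfolded SSD2P_def, rule_format, of n
      "\<lambda>i. slice UNIV (F i) (\<beta> / 2)" "\<beta> / 2"] \<open>0 < \<beta>\<close>
    by simp
  then obtain x y where y: "y \<in> unit_ball UNIV" "1 - \<beta> / 2 < norm y"
    and x: "\<And>i. i \<in> {1..n} \<Longrightarrow> x i \<in> slice UNIV (F i) (\<beta> / 2) \<and>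
      x i + y \<in> slice UNIV (F i) (\<beta> / 2) \<and> x i - y \<in> slice UNIV (F i) (\<beta> / 2)"
    by blast
  have "norm y \<le> 1" using y by (simp add: unit_ball_def)
  \<comment> \<open>The points where \<open>f i \<circ> T\<close> has to imitate \<open>F i\<close>, together with \<open>y\<close>, whose norm \<open>T\<close> has to
    preserve up to its tolerance.\<close>
  define B where "B = insert y (\<Union>i\<in>{1..n}. {x i, x i + y, x i - y})"
  have "finite B" by (simp add: B_def)
  have "0 < \<beta> / 8" using \<open>0 < \<beta>\<close> by simp
  from approx[OF \<open>finite B\<close> this] obtain T where T: "ai_operator Y (span B) (\<beta> / 8) T"
    and close: "\<And>i z. i \<in> {1..n} \<Longrightarrow> z \<in> B \<Longrightarrow> \<bar>f i (T z) - F i z\<bar> < \<beta> / 8"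
    by blast
  define R where "R = (\<lambda>z. T z /\<^sub>R (1 + \<beta> / 8))"
  have push: "R z \<in> S i" if "i \<in> {1..n}" "z \<in> B" "z \<in> slice UNIV (F i) (\<beta> / 2)" for i z
  proof -
    have "R z \<in> slice Y (f i) \<beta>"
      using slice_push_down[OF \<open>subspace Y\<close> f \<beta>(1) T, of i z "F i"] close[OF that(1,2)] that
      unfolding R_def by (simp add: span_base)
    then show ?thesis
      using slice_mono[OF \<beta>(4)] S_eq that(1) by blast
  qed
  have add: "R (u + v) = R u + R v" "R (u - v) = R u - R v" if "u \<in> span B" "v \<in> span B" for u v
    using ai_operatorD(1)[OF T, of u v] ai_operatorD(1)[OF T, of u "- 1 *\<^sub>R v"]
      ai_operatorD(2)[OF T, of v "-1"] that
    by (auto simp: R_def scaleR_add_right scaleR_diff_right span_neg)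
  have yB: "y \<in> span B" by (simp add: B_def span_base)
  have "norm (T y) \<le> (1 + \<beta> / 8) * norm y" using ai_operatorD(5)[OF T yB] .
  also have "\<dots> \<le> (1 + \<beta> / 8) * 1" using \<open>norm y \<le> 1\<close> \<beta>(1) by (intro mult_left_mono) auto
  finally have "R y \<in> unit_ball Y"
    using ai_operatorD(3)[OF T yB] \<beta> \<open>subspace Y\<close>
    by (simp add: R_def unit_ball_def subspace_scale field_simps)
  moreover have "1 - \<epsilon> < norm (R y)"
  proof -
    have "(1 - \<beta>) * (1 + \<beta> / 8) < 1 - \<beta> / 2 - \<beta> / 8" using scaling_loss[OF \<beta>(1)] .
    also have "\<dots> \<le> (1 - \<beta> / 8) * (1 - \<beta> / 2)" using \<beta>(1) by (simp add: field_simps)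
    also have "\<dots> \<le> (1 - \<beta> / 8) * norm y" using y \<beta> by (intro mult_left_mono) auto
    also have "\<dots> \<le> norm (T y)" using ai_operatorD(4)[OF T yB] .
    finally have "1 - \<beta> < norm (T y) / (1 + \<beta> / 8)" using \<beta>(1) by (simp add: pos_less_divide_eq)
    also have "\<dots> = norm (R y)" using \<beta>(1) by (simp add: R_def field_simps)
    finally show ?thesis using \<beta>(3) by linarith
  qed
  moreover have "R (x i) \<in> S i \<and> R (x i) + R y \<in> S i \<and> R (x i) - R y \<in> S i" if i: "i \<in> {1..n}" for i
  proof -
    have B: "x i \<in> B" "x i + y \<in> B" "x i - y \<in> B" using i by (auto simp: B_def)
    then show ?thesis
      using push[OF i B(1)] push[OF i B(2)] push[OF i B(3)] x[OF i] add[OF span_base[OF B(1)] yB]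
      by simp
  qed
  ultimately show "\<exists>x y. y \<in> unit_ball Y \<and> norm y > 1 - \<epsilon> \<and>
        (\<forall>i\<in>{1..n}. x i \<in> S i \<and> x i + y \<in> S i \<and> x i - y \<in> S i)"
    by (intro exI[of _ "\<lambda>i. R (x i)"] exI[of _ "R y"]) blast
qed

end
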